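(* Let $k\ge 1$ be an integer and let $(P_{k,n})_{n\ge0}$ be the generalized $k$-Pell-Tribonacci sequence. For every integer $n\geq 0$, $$\sum_{i=0}^{n}iP_{k,i}=\frac{(a_1n+a_2)P_{k,n+3}+(b_1n+b_2)P_{k,n+2}+(c_1n+c_2)P_{k,n+1}+d}{9k^2},$$ where $a_1=3k$, $a_2=5k-3$, $b_1=3k-6k^2$, $b_2=-10k^2+8k-3$, $c_1=3k-9k^2$, $c_2=-9k^2+8k-3$, and $d=k+3$.
   Context: For an integer $k\geq 1$, the generalized $k$-Pell-Tribonacci sequence $(P_{k,n})_{n\ge 0}$ is defined by $P_{k,0}=0$, $P_{k,1}=1$, $P_{k,2}=2k$ and $P_{k,n}=2kP_{k,n-1}+kP_{k,n-2}+P_{k,n-3}$ for $n\geq 3$. *)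

theory Defs imports Complex_Main begin

fun pell_tribonacci :: "int \<Rightarrow> nat \<Rightarrow> int" where
  "pell_tribonacci k 0 = 0"
| "pell_tribonacci k (Suc 0) = 1"
| "pell_tribonacci k (Suc (Suc 0)) = 2 * k"
| "pell_tribonacci k (Suc (Suc (Suc n))) =
     2 * k * pell_tribonacci k (Suc (Suc n)) + k * pell_tribonacci k (Suc n) + pell_tribonacci k n"

end

theory Submission imports Defs begin

text \<open>The characteristic polynomial x^3 - 2kx^2 - kx - 1 takes the value -3k at x = 1; the
  weight i squares this, hence the denominator 9k^2. With it cleared, the claim is a polynomial
  identity over the integers, proved by induction: passing from n to n + 1 increases the right-hand
  side by 9k^2 (n+1) P_{n+1}, and the constant k + 3 makes it vanish at n = 0.\<close>

lemma sum_index_pell_tribonacci: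
  "9 * k^2 * (\<Sum>i=0..n. int i * pell_tribonacci k i) =
    (3 * k * int n + (5 * k - 3)) * pell_tribonacci k (n + 3)
    + ((3 * k - 6 * k^2) * int n + (- 10 * k^2 + 8 * k - 3)) * pell_tribonacci k (n + 2)
    + ((3 * k - 9 * k^2) * int n + (- 9 * k^2 + 8 * k - 3)) * pell_tribonacci k (n + 1)
    + (k + 3)"
proof (induction n)
  case 0
  show ?case
    by (simp add: eval_nat_numeral algebra_simps)
next
  case (Suc n)
  have rec: "pell_tribonacci k (Suc n + 3) = 2 * k * pell_tribonacci k (n + 3)
      + k * pell_tribonacci k (n + 2) + pell_tribonacci k (n + 1)"
    by (simp add: eval_nat_numeral)
  \<comment> \<open>With \<open>rec\<close>, this leaves only the terms at n+1, n+2 and n+3, which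
    \<open>algebra\<close> can treat as independent variables.\<close>
  have shift: "Suc n + 2 = n + 3" "Suc n + 1 = n + 2"
    by simp_all
  have "9 * k^2 * (\<Sum>i=0..Suc n. int i * pell_tribonacci k i) =
      9 * k^2 * (\<Sum>i=0..n. int i * pell_tribonacci k i)
      + 9 * k^2 * ((int n + 1) * pell_tribonacci k (n + 1))"
    by (simp add: algebra_simps)
  then show ?case
    unfolding Suc.IH rec shift of_nat_Suc by algebra
qed

theorem proposition3:
  fixes k :: int and n :: nat and a1 a2 b1 b2 c1 c2 d :: int
  assumes "k \<ge> 1"
    and "a1 = 3 * k" and "a2 = 5 * k - 3"
    and "b1 = 3 * k - 6 * k^2" and "b2 = - 10 * k^2 + 8 * k - 3"
    and "c1 = 3 * k - 9 * k^2" and "c2 = - 9 * k^2 + 8 * k - 3"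
    and "d = k + 3"
  shows "real_of_int (\<Sum>i=0..n. int i * pell_tribonacci k i) =
    real_of_int ((a1 * int n + a2) * pell_tribonacci k (n + 3)
      + (b1 * int n + b2) * pell_tribonacci k (n + 2)
      + (c1 * int n + c2) * pell_tribonacci k (n + 1) + d)
    / real_of_int (9 * k^2)"
proof -
  have "real_of_int (9 * k^2) \<noteq> 0"
    using assms(1) by simp
  then show ?thesis
    \<comment> \<open>Folding the numerator back gives 9k^2 times the sum. Fixing the left factor in
      \<open>of_int_mult\<close> keeps \<open>real_of_int (9 * k^2)\<close> whole, so it cancels
      against the denominator.\<close>
    unfolding assms(2-) sum_index_pell_tribonacci[symmetric] of_int_mult[of "9 * k^2"]
    by (rule nonzero_mult_div_cancel_left[symmetric])
qed

end
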